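(* Let $V$ be a countable set, $u\ge2$, and let $\pi_{u-1}$ and $\pi_u$ be two positive finite measures on $V$. Let $K_u$ be a Markov transition operator on $V$ with invariant measure $\pi_u$. Assume that $\pi_u(x)\ge\pi_{u-1}(x)$ for all $x\in V$. Let $K_u^*$ be the dual of $K_u:\ell^2(\pi_u)\to\ell^2(\pi_u)$ and $K_u^{\Rightarrow}:\ell^2(\pi_{u-1})\to\ell^2(\pi_u)$ the dual of $K_u:\ell^2(\pi_u)\to\ell^2(\pi_{u-1})$. Then $$\forall a,b\in[1,\infty],\quad\left\|K_u^{\Rightarrow}\right\|_{\ell^a(\pi_{u-1})\to\ell^b(\pi_u)}\le\left\|K_u^*\right\|_{\ell^a(\pi_u)\to\ell^b(\pi_u)}.$$
   Context: A Markov transition operator $K$ on $V$ is a map $K:V\times V\to[0,1]$ with $\sum_y K(x,y)=1$ for all $x$; $(Kf)(x)=\sum_yK(x,y)f(y)$; $\pi$ is invariant for $K$ if $\sum_x\pi(x)K(x,y)=\pi(y)$ for all $y$. Positive means $\pi(x)>0$ for all $x$. Norms: $\|f\|_{\ell^p(\pi)}=(\sum_x|f(x)|^p\pi(x))^{1/p}$ for $p<\infty$, $\|f\|_{\ell^\infty(\pi)}=\sup_x|f(x)|$; operator norms take values in $[0,+\infty]$. The duals are given by the kernels $K_u^*(x,y)=\frac{\pi_u(y)}{\pi_u(x)}K_u(y,x)$ and $K_u^{\Rightarrow}(x,y)=\frac{\pi_{u-1}(y)}{\pi_u(x)}K_u(y,x)$, acting on functions by $f\mapsto\sum_yK_u^*(\cdot,y)f(y)$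 and $f\mapsto\sum_yK_u^{\Rightarrow}(\cdot,y)f(y)$; in particular $\langle K_uf,g\rangle_{\pi_{u-1}}=\langle f,K_u^{\Rightarrow}g\rangle_{\pi_u}$ for $f\in\ell^2(\pi_u)$, $g\in\ell^2(\pi_{u-1})$, where $\langle f,g\rangle_\pi=\sum_xf(x)g(x)\pi(x)$. *)

theory Defs
  imports "HOL-Analysis.Analysis"
begin

text \<open>
  The state space is a set \<open>V\<close>, a measure on \<open>V\<close> is given by its point masses, and a kernel on
  \<open>V\<close> by a two-argument function; only the values on \<open>V\<close> matter.
\<close>

definition positive_finite_measure :: "'v set \<Rightarrow> ('v \<Rightarrow> real) \<Rightarrow> bool" where
  "positive_finite_measure V \<mu> \<longleftrightarrow> (\<forall>x\<in>V. \<mu> x > 0) \<and> \<mu> summable_on V"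

definition markov_kernel :: "'v set \<Rightarrow> ('v \<Rightarrow> 'v \<Rightarrow> real) \<Rightarrow> bool" where
  "markov_kernel V K \<longleftrightarrow>
     (\<forall>x\<in>V. \<forall>y\<in>V. 0 \<le> K x y \<and> K x y \<le> 1) \<and> (\<forall>x\<in>V. (K x has_sum 1) V)"

definition invariant_measure :: "'v set \<Rightarrow> ('v \<Rightarrow> 'v \<Rightarrow> real) \<Rightarrow> ('v \<Rightarrow> real) \<Rightarrow> bool" where
  "invariant_measure V K \<mu> \<longleftrightarrow> (\<forall>y\<in>V. ((\<lambda>x. \<mu> x * K x y) has_sum \<mu> y) V)"

definition lp_norm :: "'v set \<Rightarrow> ('v \<Rightarrow> real) \<Rightarrow> ennreal \<Rightarrow> ('v \<Rightarrow> real) \<Rightarrow> ennreal" where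
  "lp_norm V \<mu> p f =
     (if p = \<infinity> then SUP x\<in>V. ennreal \<bar>f x\<bar>
      else if (\<lambda>x. \<bar>f x\<bar> powr enn2real p * \<mu> x) summable_on V
      then ennreal ((\<Sum>\<^sub>\<infinity>x\<in>V. \<bar>f x\<bar> powr enn2real p * \<mu> x) powr (1 / enn2real p))
      else \<infinity>)"

definition op_norm ::
  "'v set \<Rightarrow> ('v \<Rightarrow> real) \<Rightarrow> ennreal \<Rightarrow> ('v \<Rightarrow> real) \<Rightarrow> ennreal \<Rightarrow>
   (('v \<Rightarrow> real) \<Rightarrow> ('v \<Rightarrow> real)) \<Rightarrow> ennreal" where
  "op_norm V \<mu> a \<nu> b T = (SUP f\<in>{f. lp_norm V \<mu> a f \<le> 1}. lp_norm V \<nu> b (T f))"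

text \<open>
  An unconditional sum that does not converge has the value \<open>0\<close>. For the kernels below this never
  matters: the masses are finite, so every \<open>f\<close> of finite \<open>\<ell>\<^sup>a\<close>-norm, \<open>a \<ge> 1\<close>, is also in
  \<open>\<ell>\<^sup>1\<close>, and the entries of \<open>K\<close> are bounded by \<open>1\<close>.
\<close>

definition kernel_op :: "'v set \<Rightarrow> ('v \<Rightarrow> 'v \<Rightarrow> real) \<Rightarrow> ('v \<Rightarrow> real) \<Rightarrow> ('v \<Rightarrow> real)" where
  "kernel_op V K f = (\<lambda>x. \<Sum>\<^sub>\<infinity>y\<in>V. K x y * f y)"

definition inner_on :: "'v set \<Rightarrow> ('v \<Rightarrow> real) \<Rightarrow> ('v \<Rightarrow> real) \<Rightarrow> ('v \<Rightarrow> real) \<Rightarrow> real" where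
  "inner_on V \<mu> f g = (\<Sum>\<^sub>\<infinity>x\<in>V. f x * g x * \<mu> x)"

text \<open>
  \<open>dual_kernel \<mu> \<nu> K\<close> is the kernel of the dual \<open>\<ell>\<^sup>2(\<mu>) \<rightarrow> \<ell>\<^sup>2(\<nu>)\<close> of
  \<open>K : \<ell>\<^sup>2(\<nu>) \<rightarrow> \<ell>\<^sup>2(\<mu>)\<close>. So \<open>K\<^sub>u\<^sup>*\<close> is the case \<open>\<mu> = \<nu> = \<pi>\<^sub>u\<close>, and
  \<open>K\<^sub>u\<^sup>\<Rightarrow>\<close> is the case \<open>\<mu> = \<pi>\<^sub>u\<^sub>-\<^sub>1\<close>, \<open>\<nu> = \<pi>\<^sub>u\<close>.
\<close>

definition dual_kernel ::
  "('v \<Rightarrow> real) \<Rightarrow> ('v \<Rightarrow> real) \<Rightarrow> ('v \<Rightarrow> 'v \<Rightarrow> real) \<Rightarrow> 'v \<Rightarrow> 'v \<Rightarrow> real" where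
  "dual_kernel \<mu> \<nu> K x y = \<mu> y / \<nu> x * K y x"

lemma lp_norm_2_finite_imp_summable:
  assumes "lp_norm V \<mu> 2 f < \<infinity>"
  shows "(\<lambda>x. (f x)\<^sup>2 * \<mu> x) summable_on V"
proof -
  have e: "\<bar>f x\<bar> powr enn2real 2 * \<mu> x = (f x)\<^sup>2 * \<mu> x" for x
    by (cases "f x = 0") (auto simp: powr_numeral)
  have "(\<lambda>x. \<bar>f x\<bar> powr enn2real 2 * \<mu> x) summable_on V"
    using assms unfolding lp_norm_def by (auto split: if_splits)
  then show ?thesis by (simp only: e)
qed

text \<open>The kernel above does give the dual operator.\<close>

lemma dual_kernel_adjoint:
  assumes \<mu>: "positive_finite_measure V \<mu>" and \<nu>: "positive_finite_measure V \<nu>"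
    and K: "markov_kernel V K" and inv: "invariant_measure V K \<nu>"
    and le: "\<And>x. x \<in> V \<Longrightarrow> \<mu> x \<le> \<nu> x"
    and f: "lp_norm V \<nu> 2 f < \<infinity>" and g: "lp_norm V \<mu> 2 g < \<infinity>"
  shows "inner_on V \<mu> (kernel_op V K f) g = inner_on V \<nu> f (kernel_op V (dual_kernel \<mu> \<nu> K) g)"
proof -
  define F where "F = (\<lambda>x y. \<mu> x * K x y * f y * g x)"
  have K0: "0 \<le> K x y" if "x \<in> V" "y \<in> V" for x y
    using K that by (auto simp: markov_kernel_def)
  have mu0: "0 < \<mu> x" "0 < \<nu> x" if "x \<in> V" for x
    using \<mu> \<nu> that by (auto simp: positive_finite_measure_def)
  have "(\<lambda>(y, x). \<nu> x * K x y * (f y)\<^sup>2) summable_on V \<times> V"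
  proof (rule summable_on_SigmaI)
    show "((\<lambda>x. case (y, x) of (y, x) \<Rightarrow> \<nu> x * K x y * (f y)\<^sup>2) has_sum \<nu> y * (f y)\<^sup>2) V"
      if "y \<in> V" for y
      using has_sum_cmult_left[where f = "\<lambda>x. \<nu> x * K x y" and a = "\<nu> y" and A = V and c = "(f y)\<^sup>2"] inv that
      by (auto simp: invariant_measure_def)
    show "(\<lambda>y. \<nu> y * (f y)\<^sup>2) summable_on V"
      using lp_norm_2_finite_imp_summable[OF f] by (simp add: mult.commute)
  qed (use K0 mu0 in \<open>auto intro!: mult_nonneg_nonneg simp: less_imp_le\<close>)
  then have s1: "(\<lambda>(x, y). \<nu> x * K x y * (f y)\<^sup>2) summable_on V \<times> V"
    by (subst summable_on_swap) (simp add: case_prod_unfold)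
  have s2: "(\<lambda>(x, y). \<mu> x * (g x)\<^sup>2 * K x y) summable_on V \<times> V"
  proof (rule summable_on_SigmaI)
    show "((\<lambda>y. case (x, y) of (x, y) \<Rightarrow> \<mu> x * (g x)\<^sup>2 * K x y) has_sum \<mu> x * (g x)\<^sup>2) V"
      if "x \<in> V" for x
      using has_sum_cmult_right[where f = "K x" and a = 1 and A = V and c = "\<mu> x * (g x)\<^sup>2"] K that
      by (auto simp: markov_kernel_def)
    show "(\<lambda>x. \<mu> x * (g x)\<^sup>2) summable_on V"
      using lp_norm_2_finite_imp_summable[OF g] by (simp add: mult.commute)
  qed (use K0 mu0 in \<open>auto intro!: mult_nonneg_nonneg simp: less_imp_le\<close>)
  have "(\<lambda>p. norm ((\<lambda>(x, y). F x y) p)) summable_on V \<times> V"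
  proof (rule Infinite_Sum.abs_summable_on_comparison_test')
    show "(\<lambda>p. (\<lambda>(x, y). \<nu> x * K x y * (f y)\<^sup>2) p + (\<lambda>(x, y). \<mu> x * (g x)\<^sup>2 * K x y) p)
            summable_on V \<times> V"
      by (rule summable_on_add[OF s1 s2])
    fix p assume "p \<in> V \<times> V"
    then obtain x y where p: "p = (x, y)" "x \<in> V" "y \<in> V" by auto
    have n: "0 \<le> \<mu> x * K x y" using K0[OF p(2,3)] mu0[OF p(2)] by simp
    have "\<bar>f y * g x\<bar> \<le> (f y)\<^sup>2 + (g x)\<^sup>2"
    proof -
      have "2 * (\<bar>f y\<bar> * \<bar>g x\<bar>) \<le> (f y)\<^sup>2 + (g x)\<^sup>2"
        using sum_squares_bound[of "\<bar>f y\<bar>" "\<bar>g x\<bar>"] by simp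
      moreover have "0 \<le> \<bar>f y\<bar> * \<bar>g x\<bar>" by simp
      ultimately show ?thesis unfolding abs_mult by linarith
    qed
    then have "(\<mu> x * K x y) * \<bar>f y * g x\<bar> \<le> (\<mu> x * K x y) * ((f y)\<^sup>2 + (g x)\<^sup>2)"
      by (rule mult_left_mono[OF _ n])
    moreover have "\<mu> x * K x y * (f y)\<^sup>2 \<le> \<nu> x * K x y * (f y)\<^sup>2"
      using le[OF p(2)] K0[OF p(2,3)] by (intro mult_right_mono) auto
    moreover have "norm (F x y) = (\<mu> x * K x y) * \<bar>f y * g x\<bar>"
      using abs_mult[of "\<mu> x * K x y" "f y * g x"] abs_of_nonneg[OF n]
      by (simp add: F_def mult.assoc)
    ultimately show "norm ((\<lambda>(x, y). F x y) p) \<le>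
        (\<lambda>(x, y). \<nu> x * K x y * (f y)\<^sup>2) p + (\<lambda>(x, y). \<mu> x * (g x)\<^sup>2 * K x y) p"
      by (simp add: p algebra_simps)
  qed
  then have "(\<lambda>(x, y). F x y) summable_on V \<times> V"
    by (rule abs_summable_summable)
  then have swap: "(\<Sum>\<^sub>\<infinity>x\<in>V. \<Sum>\<^sub>\<infinity>y\<in>V. F x y) = (\<Sum>\<^sub>\<infinity>y\<in>V. \<Sum>\<^sub>\<infinity>x\<in>V. F x y)"
    by (rule infsum_swap_banach)
  have "kernel_op V K f x * g x * \<mu> x = (\<Sum>\<^sub>\<infinity>y\<in>V. F x y)" for x
  proof -
    have "(\<Sum>\<^sub>\<infinity>y\<in>V. F x y) = (\<Sum>\<^sub>\<infinity>y\<in>V. (g x * \<mu> x) * (K x y * f y))"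
      by (simp add: F_def algebra_simps)
    then show ?thesis by (simp add: infsum_cmult_right' kernel_op_def)
  qed
  moreover have "f y * kernel_op V (dual_kernel \<mu> \<nu> K) g y * \<nu> y = (\<Sum>\<^sub>\<infinity>x\<in>V. F x y)"
    if "y \<in> V" for y
  proof -
    have "(\<Sum>\<^sub>\<infinity>x\<in>V. F x y) = (\<Sum>\<^sub>\<infinity>x\<in>V. (f y * \<nu> y) * (dual_kernel \<mu> \<nu> K y x * g x))"
      using mu0[OF that] by (intro infsum_cong) (simp add: F_def dual_kernel_def field_simps)
    then show ?thesis by (simp add: infsum_cmult_right' kernel_op_def)
  qed
  ultimately show ?thesis
    unfolding inner_on_def using swap by (simp cong: infsum_cong)
qed

end

theory Submission
  imports Defs
begin

text \<open>
  With \<open>g = \<mu> / \<nu> \<le> 1\<close>, the operator \<open>K\<^sup>\<Rightarrow>\<close> is multiplication by \<open>g\<close> followed by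
  \<open>K\<^sup>*\<close>. Multiplication by \<open>g\<close> is a contraction \<open>\<ell>\<^sup>a(\<mu>) \<rightarrow> \<ell>\<^sup>a(\<nu>)\<close> for \<open>a \<ge> 1\<close>,
  because \<open>g\<^sup>a \<nu> \<le> g \<nu> = \<mu>\<close>.
\<close>

lemma kernel_op_dual_kernel_density:
  assumes "\<And>y. y \<in> V \<Longrightarrow> \<nu> y \<noteq> 0"
  shows "kernel_op V (dual_kernel \<mu> \<nu> K) f =
    kernel_op V (dual_kernel \<nu> \<nu> K) (\<lambda>y. \<mu> y / \<nu> y * f y)"
  unfolding kernel_op_def dual_kernel_def
  by (rule ext, rule infsum_cong) (use assms in \<open>simp add: field_simps\<close>)

lemma lp_norm_density_mult_le:
  assumes a: "1 \<le> a"
    and \<mu>: "\<And>x. x \<in> V \<Longrightarrow> 0 \<le> \<mu> x" and \<nu>: "\<And>x. x \<in> V \<Longrightarrow> 0 < \<nu> x"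
    and le: "\<And>x. x \<in> V \<Longrightarrow> \<mu> x \<le> \<nu> x"
  shows "lp_norm V \<nu> a (\<lambda>x. \<mu> x / \<nu> x * f x) \<le> lp_norm V \<mu> a f"
proof -
  have g: "0 \<le> \<mu> x / \<nu> x" "\<mu> x / \<nu> x \<le> 1" if "x \<in> V" for x
    using \<mu>[OF that] \<nu>[OF that] le[OF that] by simp_all
  show ?thesis
  proof (cases "a = \<infinity>")
    case True
    have "\<bar>\<mu> x / \<nu> x * f x\<bar> \<le> \<bar>f x\<bar>" if "x \<in> V" for x
      using mult_right_mono[OF g(2)[OF that], of "\<bar>f x\<bar>"] g(1)[OF that]
      unfolding abs_mult abs_of_nonneg[OF g(1)[OF that]] by simp
    with True show ?thesis
      unfolding lp_norm_def by (auto intro!: SUP_mono ennreal_leI)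
  next
    case False
    define p where "p = enn2real a"
    have p: "1 \<le> p"
      using a False by (cases a) (auto simp: p_def)
    let ?F = "\<lambda>x. \<bar>\<mu> x / \<nu> x * f x\<bar> powr p * \<nu> x" and ?G = "\<lambda>x. \<bar>f x\<bar> powr p * \<mu> x"
    have F0: "0 \<le> ?F x" if "x \<in> V" for x
      using \<nu>[OF that] by simp
    have FG: "?F x \<le> ?G x" if "x \<in> V" for x
    proof -
      have "(\<mu> x / \<nu> x) powr p \<le> \<mu> x / \<nu> x"
        using powr_le_one_le[of "\<mu> x / \<nu> x" p] g[OF that] p
        by (cases "0 < \<mu> x / \<nu> x") (blast, metis order.order_iff_strict powr_eq_0_iff)
      then have "(\<mu> x / \<nu> x) powr p * \<nu> x \<le> \<mu> x"
        using \<nu>[OF that] by (simp add: pos_le_divide_eq)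
      then have "\<bar>f x\<bar> powr p * ((\<mu> x / \<nu> x) powr p * \<nu> x) \<le> ?G x"
        by (intro mult_left_mono) auto
      moreover have "?F x = \<bar>f x\<bar> powr p * ((\<mu> x / \<nu> x) powr p * \<nu> x)"
        unfolding abs_mult abs_of_nonneg[OF g(1)[OF that]] using g(1)[OF that]
        by (simp only: powr_mult abs_ge_zero ac_simps)
      ultimately show ?thesis by (simp only:)
    qed
    show ?thesis
    proof (cases "?G summable_on V")
      case G: True
      have F: "?F summable_on V"
        by (rule summable_on_comparison_test[OF G FG F0])
      have "infsum ?F V \<le> infsum ?G V"
        by (rule infsum_mono[OF F G FG])
      moreover have "0 \<le> infsum ?F V"
        by (rule infsum_nonneg[OF F0])
      ultimately show ?thesis
        using F G False p unfolding lp_norm_def p_def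
        by (auto intro!: ennreal_leI powr_mono2)
    next
      case nG: False
      then show ?thesis
        using False unfolding lp_norm_def p_def by simp
    qed
  qed
qed

theorem lemma3p17:
  fixes V :: "'v set" and u :: nat
    and \<pi> :: "nat \<Rightarrow> 'v \<Rightarrow> real" and K :: "nat \<Rightarrow> 'v \<Rightarrow> 'v \<Rightarrow> real"
  assumes "countable V" and "u \<ge> 2"
    and "positive_finite_measure V (\<pi> (u - 1))" and "positive_finite_measure V (\<pi> u)"
    and "markov_kernel V (K u)" and "invariant_measure V (K u) (\<pi> u)"
    and "\<forall>x\<in>V. \<pi> u x \<ge> \<pi> (u - 1) x"
  shows "\<forall>a b :: ennreal. 1 \<le> a \<longrightarrow> 1 \<le> b \<longrightarrow>
    op_norm V (\<pi> (u - 1)) a (\<pi> u) b (kernel_op V (dual_kernel (\<pi> (u - 1)) (\<pi> u) (K u)))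
    \<le> op_norm V (\<pi> u) a (\<pi> u) b (kernel_op V (dual_kernel (\<pi> u) (\<pi> u) (K u)))"
proof (intro allI impI)
  fix a b :: ennreal
  assume a: "1 \<le> a"
  let ?\<mu> = "\<pi> (u - 1)" and ?\<nu> = "\<pi> u"
  have pos: "0 < ?\<mu> x" "0 < ?\<nu> x" "?\<mu> x \<le> ?\<nu> x" if "x \<in> V" for x
    using assms(3,4,7) that by (auto simp: positive_finite_measure_def)
  show "op_norm V ?\<mu> a ?\<nu> b (kernel_op V (dual_kernel ?\<mu> ?\<nu> (K u)))
    \<le> op_norm V ?\<nu> a ?\<nu> b (kernel_op V (dual_kernel ?\<nu> ?\<nu> (K u)))"
    unfolding op_norm_def
  proof (rule SUP_mono)
    fix f assume "f \<in> {f. lp_norm V ?\<mu> a f \<le> 1}"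
    moreover have "lp_norm V ?\<nu> a (\<lambda>x. ?\<mu> x / ?\<nu> x * f x) \<le> lp_norm V ?\<mu> a f"
      by (rule lp_norm_density_mult_le[OF a]) (use pos in \<open>auto simp: less_imp_le\<close>)
    moreover have "kernel_op V (dual_kernel ?\<mu> ?\<nu> (K u)) f =
        kernel_op V (dual_kernel ?\<nu> ?\<nu> (K u)) (\<lambda>y. ?\<mu> y / ?\<nu> y * f y)"
      by (rule kernel_op_dual_kernel_density) (use pos in force)
    ultimately show "\<exists>h\<in>{f. lp_norm V ?\<nu> a f \<le> 1}.
        lp_norm V ?\<nu> b (kernel_op V (dual_kernel ?\<mu> ?\<nu> (K u)) f)
        \<le> lp_norm V ?\<nu> b (kernel_op V (dual_kernel ?\<nu> ?\<nu> (K u)) h)"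
      by (intro bexI[of _ "\<lambda>y. ?\<mu> y / ?\<nu> y * f y"]) auto
  qed
qed

end
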